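(* For every integer $n\ge 3$, the graph $OTIS(BF(n))$ is Hamiltonian, where $BF(n)$ is the butterfly graph of dimension $n$.
   Context: All graphs are finite, simple and undirected. The butterfly graph of dimension $n$, denoted $BF(n)$, is the 4-regular graph on $n2^n$ vertices defined as follows. Its vertices are the couples $(\alpha; x_{n-1},\dots,x_0)$ with $\alpha\in\{0,\dots,n-1\}$ and $x_i\in\{0,1\}$ for all $i\in\{0,\dots,n-1\}$. There is an (undirected) edge between $(\alpha;x_{n-1},\dots,x_0)$ and $(\alpha';x'_{n-1},\dots,x'_0)$ if $\alpha'\equiv\alpha+1 \pmod n$ and $x_i=x'_i$ for all $i\ne\alpha'$. For a graph $G$, the graph $OTIS(G)$ has vertex set $\{\langle u,v\rangle : u,v\in V(G)\}$ and edge set $$\{(\langle v,u\rangle,\langle v,u'\rangle) : v\in V(G),\ (u,u')\in E(G)\}\ \cup\ \{(\langle v,u\rangle,\langle u,v\rangle) : u,v\in V(G),\ u\ne v\}.$$ A graph is Hamiltonian if it has a cycle passing through every vertex exactly once. *)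

theory Defs
  imports "Graph_Theory.Pair_Digraph"
begin

text \<open>Simple undirected graphs are the irreflexive symmetric pair digraphs of locale
  \<^locale>\<open>pair_graph\<close>: an edge is represented by its two orientations.\<close>

subsection \<open>The butterfly graph\<close>

text \<open>A vertex \<open>(a; x_{n-1}, ..., x_0)\<close> is the pair \<open>(a, x)\<close> with \<open>x\<close> a list of
  \<open>n\<close> bits such that \<open>x ! i\<close> is the coordinate \<open>x_i\<close>.\<close>

type_synonym bf_vertex = "nat \<times> bool list"

definition bf_vertices :: "nat \<Rightarrow> bf_vertex set" where
  "bf_vertices n = {(a, x). a < n \<and> length x = n}"

fun bf_step :: "nat \<Rightarrow> bf_vertex \<Rightarrow> bf_vertex \<Rightarrow> bool" where
  "bf_step n (a, x) (a', x') \<longleftrightarrow>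
     a' mod n = (a + 1) mod n \<and> (\<forall>i<n. i \<noteq> a' \<longrightarrow> x ! i = x' ! i)"

definition BF :: "nat \<Rightarrow> bf_vertex pair_pre_digraph" where
  "BF n = \<lparr> pverts = bf_vertices n,
     parcs = {(u, v). u \<in> bf_vertices n \<and> v \<in> bf_vertices n \<and> (bf_step n u v \<or> bf_step n v u)} \<rparr>"

subsection \<open>OTIS graphs\<close>

definition OTIS :: "'a pair_pre_digraph \<Rightarrow> ('a \<times> 'a) pair_pre_digraph" where
  "OTIS G = \<lparr> pverts = pverts G \<times> pverts G,
     parcs = {((v, u), (v, u')) | v u u'. v \<in> pverts G \<and> (u, u') \<in> parcs G}
           \<union> {((v, u), (u, v)) | u v. u \<in> pverts G \<and> v \<in> pverts G \<and> u \<noteq> v} \<rparr>"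

subsection \<open>Hamiltonian graphs\<close>

text \<open>The library's cycles do not repeat a vertex, but they include the closed walk
  \<open>u, v, u\<close> along the two orientations of one edge; the length bound excludes it.\<close>

definition hamiltonian :: "'a pair_pre_digraph \<Rightarrow> bool" where
  "hamiltonian G \<longleftrightarrow>
     (\<exists>p. pre_digraph.cycle (with_proj G) p \<and> 3 \<le> length p \<and> fst ` set p = pverts G)"

subsection \<open>Basic properties\<close>

lemma bf_vertices_eq: "bf_vertices n = {..<n} \<times> {x. length x = n}"
  by (auto simp: bf_vertices_def)

lemma finite_bf_vertices: "finite (bf_vertices n)"
  using finite_lists_length_eq[of "UNIV :: bool set" n] by (simp add: bf_vertices_eq)

lemma card_BF: "card (pverts (BF n)) = n * 2 ^ n"
  using card_lists_length_eq[of "UNIV :: bool set" n]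
  by (simp add: BF_def bf_vertices_eq card_cartesian_product)

lemma mod_Suc_neq:
  fixes a n :: nat
  assumes "2 \<le> n" "a < n"
  shows "(a + 1) mod n \<noteq> a"
  using assms by (cases "a + 1 = n") auto

lemma pair_graph_BF:
  assumes "2 \<le> n"
  shows "pair_graph (BF n)"
proof
  have "parcs (BF n) \<subseteq> bf_vertices n \<times> bf_vertices n"
    by (auto simp: BF_def)
  then show "finite (parcs (BF n))"
    using finite_bf_vertices finite_subset by blast
  show "symmetric (with_proj (BF n))"
    by (auto simp: symmetric_def sym_def BF_def)
  show "fst e \<noteq> snd e" if "e \<in> parcs (BF n)" for e
    using that mod_Suc_neq[OF assms] by (cases e) (force simp: BF_def bf_vertices_def)
qed (auto simp: BF_def finite_bf_vertices)

lemma out_degree_BF: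
  assumes "3 \<le> n" "v \<in> pverts (BF n)"
  shows "out_degree (with_proj (BF n)) v = 4"
proof -
  obtain a x where v: "v = (a, x)" and a: "a < n" and x: "length x = n"
    using assms(2) by (auto simp: BF_def bf_vertices_def)
  define b where "b = (a + 1) mod n"
  define c where "c = (if a = 0 then n - 1 else a - 1)"
  have b: "b < n" and c: "c < n" using a assms(1) by (auto simp: b_def c_def)
  have bc: "b \<noteq> c"
    using a assms(1) by (cases "a + 1 = n") (auto simp: b_def c_def)
  have c_iff: "d = c" if "d < n" "a = (d + 1) mod n" for d
    using that by (cases "d + 1 = n") (auto simp: c_def)
  have c_succ: "(c + 1) mod n = a" using a assms(1) by (auto simp: c_def)
  have upd: "y = x[i := y ! i]"
    if "length y = n" "\<forall>j<n. j \<noteq> i \<longrightarrow> x ! j = y ! j" for y i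
  proof (rule nth_equalityI)
    show "y ! j = x[i := y ! i] ! j" if "j < length y" for j
      using that x \<open>length y = n\<close> \<open>\<forall>j<n. j \<noteq> i \<longrightarrow> x ! j = y ! j\<close>
      by (cases "j = i") simp_all
  qed (simp add: x that(1))
  let ?N = "{(b, x[b := False]), (b, x[b := True]), (c, x[a := False]), (c, x[a := True])}"
  have N: "w \<in> ?N" if w: "(v, w) \<in> parcs (BF n)" for w
  proof -
    obtain d y where dy: "w = (d, y)" "d < n" "length y = n"
      using w by (auto simp: BF_def bf_vertices_def)
    from w have "bf_step n v w \<or> bf_step n w v" by (auto simp: BF_def)
    then show ?thesis
    proof
      assume s: "bf_step n v w"
      then have "d = b" using dy by (auto simp: v b_def)
      moreover have "y = x[b := y ! b]" using s dy \<open>d = b\<close> by (intro upd) (auto simp: v)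
      ultimately show ?thesis using dy by (cases "y ! b") auto
    next
      assume s: "bf_step n w v"
      then have "d = c" using dy a by (intro c_iff) (auto simp: v)
      moreover have "y = x[a := y ! a]" using s dy by (intro upd) (auto simp: v)
      ultimately show ?thesis using dy by (cases "y ! a") auto
    qed
  qed
  have "out_arcs (with_proj (BF n)) v = Pair v ` ?N"
  proof (intro equalityI subsetI)
    fix e assume "e \<in> out_arcs (with_proj (BF n)) v"
    then show "e \<in> Pair v ` ?N" using N by (cases e) (auto simp: out_arcs_def)
  next
    fix e assume "e \<in> Pair v ` ?N"
    then show "e \<in> out_arcs (with_proj (BF n)) v"
      using a b c x c_succ
      by (auto simp: out_arcs_def BF_def bf_vertices_def v b_def[symmetric])
         (auto simp: b_def)
  qed
  moreover have ne: "x[i := False] \<noteq> x[i := True]" if "i < n" for i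
    using that x by (metis nth_list_update_eq)
  have "card ?N = 4" using bc ne[OF a] ne[OF b] by simp
  moreover have "card (Pair v ` ?N) = card ?N" by (rule card_image) (simp add: inj_on_def)
  ultimately show ?thesis by (simp only: out_degree_def)
qed

lemma pair_graph_OTIS:
  assumes "pair_graph G"
  shows "pair_graph (OTIS G)"
proof -
  interpret pair_graph G by fact
  show ?thesis
  proof
    have "parcs (OTIS G) \<subseteq> (pverts G \<times> pverts G) \<times> (pverts G \<times> pverts G)"
      by (auto simp: OTIS_def dest: in_arcsD1 in_arcsD2)
    then show "finite (parcs (OTIS G))"
      by (rule finite_subset) (intro finite_cartesian_product pair_finite_verts)
    have "(u', u) \<in> parcs G" if "(u, u') \<in> parcs G" for u u'
      using pair_sym_arcs that by (auto simp: symmetric_def sym_def)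
    then show "symmetric (with_proj (OTIS G))"
      by (auto simp: symmetric_def sym_def OTIS_def)
    show "fst e \<noteq> snd e" if "e \<in> parcs (OTIS G)" for e
      using that pair_no_loops by (auto simp: OTIS_def)
  qed (auto simp: OTIS_def pair_finite_verts dest: in_arcsD1 in_arcsD2)
qed

end

theory Submission
  imports Defs
begin

text \<open>The butterfly graph splits into the \<open>2^n\<close> cycles that run through all levels with a fixed
  bit string. Two such cycles whose strings differ in bit \<open>k\<close> merge when their edges from level
  \<open>k - 1\<close> to level \<open>k\<close> are replaced by the two crossing edges; merging along a spanning tree of the
  hypercube gives a Hamiltonian cycle of length \<open>N\<close>.

  It remains to find a Hamiltonian cycle of \<open>OTIS(C_N)\<close>, whose vertices \<open>(v, u)\<close> form an
  \<open>N \<times> N\<close> grid with cyclic rows and with edges to the transposed position. A cycle through the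
  rows \<open>0, ..., m - 1\<close> that contains the edge of row \<open>m - 1\<close> between columns \<open>m + 1\<close> and \<open>m + 2\<close>
  absorbs the rows \<open>m, m + 1, m + 2\<close>: remove the edges at columns \<open>m + 1, m + 2\<close> from rows
  \<open>m - 1, m\<close> and those at columns \<open>m - 1, m\<close> from rows \<open>m + 1, m + 2\<close>, and insert the four
  transposition edges between these eight vertices. Starting values of \<open>m\<close> in the three residue
  classes modulo 3 are 1, 6 and 8.\<close>

section \<open>Closed vertex lists\<close>

definition closed_successively :: "('a \<Rightarrow> 'a \<Rightarrow> bool) \<Rightarrow> 'a list \<Rightarrow> bool" where
  "closed_successively E vs \<longleftrightarrow> successively E vs \<and> vs \<noteq> [] \<and> E (last vs) (hd vs)"

text \<open>The closing edge from \<open>last xs\<close> to \<open>u\<close> gives way to a detour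
  through \<open>ys\<close>. With \<open>u\<close> moved to the end, its edge to
  \<open>hd xs\<close> becomes the new closing edge.\<close>

lemma closed_successively_merge:
  assumes "closed_successively E (u # xs)" "xs \<noteq> []" "successively E ys" "ys \<noteq> []"
    and "E (last xs) (hd ys)" "E (last ys) u"
  shows "closed_successively E (xs @ ys @ [u])"
  using assms by (auto simp: closed_successively_def successively_append_iff successively_Cons)

lemma successively_imp_awalk:
  assumes "successively (\<lambda>u v. (u, v) \<in> parcs G) w" "w \<noteq> []" "hd w \<in> pverts G"
  obtains p where "pre_digraph.awalk (with_proj G) (hd w) p (last w)"
    and "pre_digraph.awalk_verts (with_proj G) (hd w) p = w"
proof -
  have "\<exists>p. pcas (hd w) p (last w) \<and> set p \<subseteq> parcs G \<and> pawalk_verts (hd w) p = w"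
    using assms(1,2)
  proof (induction w)
    case (Cons x xs)
    show ?case
    proof (cases xs)
      case Nil
      then show ?thesis by (intro exI[of _ "[]"]) simp
    next
      case (Cons y ys)
      with Cons.IH Cons.prems obtain p
        where "pcas y p (last xs) \<and> set p \<subseteq> parcs G \<and> pawalk_verts y p = xs"
        by (auto simp: successively_Cons)
      with Cons Cons.prems show ?thesis
        by (intro exI[of _ "(x, y) # p"]) (auto simp: successively_Cons)
    qed
  qed simp
  with assms(3) show ?thesis
    by (auto simp: pre_digraph.awalk_def cas_with_proj_eq awalk_verts_with_proj_eq intro: that)
qed

lemma hamiltonianI:
  assumes closed: "closed_successively (\<lambda>u v. (u, v) \<in> parcs G) vs"
    and "distinct vs" "set vs = pverts G" "3 \<le> length vs"
  shows "hamiltonian G"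
proof -
  define w where "w = vs @ [hd vs]"
  have vs: "vs \<noteq> []" using closed by (simp add: closed_successively_def)
  have "successively (\<lambda>u v. (u, v) \<in> parcs G) w"
    using closed by (auto simp: w_def closed_successively_def successively_append_iff)
  moreover have "hd w \<in> pverts G"
    using vs assms(3) hd_in_set[OF vs] by (simp add: w_def)
  ultimately obtain p where "pre_digraph.awalk (with_proj G) (hd w) p (last w)"
    "pre_digraph.awalk_verts (with_proj G) (hd w) p = w"
    using successively_imp_awalk[of G w] by (auto simp: w_def)
  then have p: "pre_digraph.awalk (with_proj G) (hd vs) p (hd vs)"
    "pre_digraph.awalk_verts (with_proj G) (hd vs) p = vs @ [hd vs]"
    using vs by (simp_all add: w_def)
  \<comment> \<open>The vertices of a nonempty walk are the tails of its arcs followed by its end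
    point, so the final \<open>hd vs\<close> drops out.\<close>
  from p(2) have "p \<noteq> []" and map_p: "map fst p = vs"
    using vs by (simp_all add: pre_digraph.awalk_verts_conv split: if_splits)
  moreover have "distinct (tl (vs @ [hd vs]))"
    using \<open>distinct vs\<close> vs by (cases vs) auto
  ultimately have "pre_digraph.cycle (with_proj G) p"
    unfolding pre_digraph.cycle_def using p by metis
  moreover have "length p = length vs" "fst ` set p = pverts G"
    using map_p assms(3) by (auto simp flip: map_p)
  ultimately show ?thesis
    using assms(4) by (auto simp: hamiltonian_def)
qed

section \<open>A Hamiltonian cycle of the butterfly graph\<close>

text \<open>The result of merging the \<open>2^k\<close> level cycles whose strings agree with \<open>z\<close> from bit \<open>k\<close>
  on. For \<open>k < n\<close> the list starts with the edges from \<open>(k, z)\<close> up to \<open>(n - 1, z)\<close>, which the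
  later merges need; dropping its head and appending it again rotates the cycle.\<close>

fun bf_cycle :: "nat \<Rightarrow> nat \<Rightarrow> bool list \<Rightarrow> bf_vertex list" where
  "bf_cycle n 0 z = map (\<lambda>a. (a, z)) [0..<n]"
| "bf_cycle n (Suc k) z = tl (bf_cycle n k z) @ bf_cycle n k (z[k := \<not> z ! k]) @ [(k, z)]"

abbreviation bf_adj :: "nat \<Rightarrow> bf_vertex \<Rightarrow> bf_vertex \<Rightarrow> bool" where
  "bf_adj n u v \<equiv> (u, v) \<in> parcs (BF n)"

lemma bf_adj_up:
  assumes "a < n" "b = Suc a mod n" "length x = n" "length y = n" "\<forall>i<n. i \<noteq> b \<longrightarrow> x ! i = y ! i"
  shows "bf_adj n (a, x) (b, y)"
  using assms by (auto simp: BF_def bf_vertices_def)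

lemma bf_cycle_prefix:
  assumes "k \<le> n"
  shows "\<exists>r. bf_cycle n k z = map (\<lambda>a. (a, z)) [k..<n] @ r"
  using assms
proof (induction k arbitrary: z)
  case (Suc k)
  then obtain r where "bf_cycle n k z = map (\<lambda>a. (a, z)) [k..<n] @ r" by fastforce
  with Suc.prems show ?case by (simp add: upt_conv_Cons)
qed simp

lemma bf_cycle_Cons:
  assumes "k < n"
  shows "\<exists>A. bf_cycle n k z = (k, z) # A"
  using bf_cycle_prefix[of k n z] assms by (auto simp: upt_conv_Cons)

lemma length_bf_cycle:
  assumes "k \<le> n"
  shows "length (bf_cycle n k z) = n * 2 ^ k"
  using assms
proof (induction k arbitrary: z)
  case (Suc k)
  then have "n * 2 ^ k > 0" by simp
  with Suc show ?case by simp
qed simp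

text \<open>Merging at bit \<open>k\<close> frees that bit: a string that agrees with
  \<open>z\<close> beyond bit \<open>k\<close> agrees at bit \<open>k\<close> either with
  \<open>z\<close> or with its flip, and these give the two merged cycles.\<close>

lemma set_bf_cycle:
  assumes "k \<le> n" "length z = n"
  shows "set (bf_cycle n k z) = {(a, x). a < n \<and> length x = n \<and> (\<forall>i<n. k \<le> i \<longrightarrow> x ! i = z ! i)}"
  using assms
proof (induction k arbitrary: z)
  case 0
  then have "(\<forall>i<n. x ! i = z ! i) \<longleftrightarrow> x = z" if "length x = n" for x
    using that by (auto intro: nth_equalityI)
  with 0 show ?case by auto
next
  case (Suc k)
  define z' where "z' = z[k := \<not> z ! k]"
  obtain A where A: "bf_cycle n k z = (k, z) # A"
    using bf_cycle_Cons[of k n z] Suc.prems by auto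
  have split: "(\<forall>i<n. Suc k \<le> i \<longrightarrow> x ! i = z ! i) \<longleftrightarrow>
      (\<forall>i<n. k \<le> i \<longrightarrow> x ! i = z ! i) \<or> (\<forall>i<n. k \<le> i \<longrightarrow> x ! i = z' ! i)" for x
  proof -
    have step: "(\<forall>i<n. k \<le> i \<longrightarrow> P i) \<longleftrightarrow> P k \<and> (\<forall>i<n. Suc k \<le> i \<longrightarrow> P i)" for P
      using Suc.prems(1) by (auto simp: le_eq_less_or_eq Suc_le_eq)
    show ?thesis
      unfolding step[of "\<lambda>i. x ! i = z ! i"] step[of "\<lambda>i. x ! i = z' ! i"]
      using Suc.prems by (auto simp: z'_def)
  qed
  have "set (bf_cycle n (Suc k) z) = set (bf_cycle n k z) \<union> set (bf_cycle n k z')"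
    by (auto simp: A z'_def)
  also have "\<dots> = {(a, x). a < n \<and> length x = n \<and> (\<forall>i<n. Suc k \<le> i \<longrightarrow> x ! i = z ! i)}"
    using Suc.prems by (subst (1 2) Suc.IH) (auto simp: split z'_def)
  finally show ?case .
qed

text \<open>Knowing the last vertex drives the induction: for \<open>k < n\<close> the closing edge
  enters level \<open>k\<close> from the level cyclically below, so it may change bit
  \<open>k\<close>. The closing edges of the two cycles can thus be exchanged for the crossing
  edges.\<close>

lemma closed_bf_cycle:
  assumes "3 \<le> n" "k \<le> n" "length z = n"
  shows "closed_successively (bf_adj n) (bf_cycle n k z) \<and>
    last (bf_cycle n k z) = (if k = 0 then n - 1 else k - 1, z)"
  using assms(2,3)
proof (induction k arbitrary: z)
  case 0
  have "successively (bf_adj n) (map (\<lambda>a. (a, z)) [0..<n])"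
    using 0 by (auto simp: successively_conv_nth intro!: bf_adj_up)
  moreover have "bf_adj n (n - 1, z) (0, z)"
    using 0 assms(1) by (intro bf_adj_up) simp_all
  ultimately show ?case
    using assms(1) by (simp add: closed_successively_def hd_map last_map)
next
  case (Suc k)
  define z' where "z' = z[k := \<not> z ! k]"
  define l where "l = (if k = 0 then n - 1 else k - 1)"
  have "k < n" using Suc.prems by simp
  then obtain A B where A: "bf_cycle n k z = (k, z) # A" and B: "bf_cycle n k z' = (k, z') # B"
    using bf_cycle_Cons by blast
  have "length (bf_cycle n k z) \<ge> n" using \<open>k < n\<close> by (simp add: length_bf_cycle)
  with A assms(1) have "A \<noteq> []" by auto
  have l: "l < n" "Suc l mod n = k" using \<open>k < n\<close> by (auto simp: l_def)
  have "length z' = n" using Suc.prems by (simp add: z'_def)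
  have zz': "\<forall>i<n. i \<noteq> k \<longrightarrow> z ! i = z' ! i" by (simp add: z'_def)
  note IH = Suc.IH[OF _ \<open>length z = n\<close>, folded l_def] Suc.IH[OF _ \<open>length z' = n\<close>, folded l_def]
  have "closed_successively (bf_adj n) (A @ bf_cycle n k z' @ [(k, z)])"
  proof (rule closed_successively_merge)
    show "closed_successively (bf_adj n) ((k, z) # A)" using IH(1) \<open>k < n\<close> by (simp add: A)
    show "successively (bf_adj n) (bf_cycle n k z')" "bf_cycle n k z' \<noteq> []"
      using IH(2) \<open>k < n\<close> by (simp_all add: closed_successively_def)
    have "last A = (l, z)" using IH(1) \<open>k < n\<close> \<open>A \<noteq> []\<close> by (simp add: A)
    then show "bf_adj n (last A) (hd (bf_cycle n k z'))"
      using l zz' \<open>length z' = n\<close> \<open>length z = n\<close> \<open>k < n\<close> by (simp add: B bf_adj_up)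
    show "bf_adj n (last (bf_cycle n k z')) (k, z)"
      using IH(2) l zz' \<open>length z' = n\<close> \<open>length z = n\<close> \<open>k < n\<close> by (simp add: bf_adj_up)
  qed fact
  then show ?case
    by (simp add: A z'_def)
qed

section \<open>OTIS of a cycle\<close>

definition otis_cycle_adj :: "nat \<Rightarrow> nat \<times> nat \<Rightarrow> nat \<times> nat \<Rightarrow> bool" where
  "otis_cycle_adj N p q \<longleftrightarrow>
     fst p = fst q \<and> (snd q = Suc (snd p) mod N \<or> snd p = Suc (snd q) mod N) \<or>
     fst p = snd q \<and> snd p = fst q \<and> fst p \<noteq> snd p"

text \<open>Columns wrap around, so \<open>l = N\<close> traverses a whole row from any starting
  column.\<close>

definition row_arc :: "nat \<Rightarrow> nat \<Rightarrow> nat \<Rightarrow> nat \<Rightarrow> (nat \<times> nat) list" where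
  "row_arc N v s l = map (\<lambda>i. (v, (s + i) mod N)) [0..<l]"

lemma length_row_arc [simp]: "length (row_arc N v s l) = l"
  by (simp add: row_arc_def)

lemma row_arc_eq_Nil_iff [simp]: "row_arc N v s l = [] \<longleftrightarrow> l = 0"
  by (simp add: row_arc_def)

lemma hd_row_arc [simp]: "0 < l \<Longrightarrow> hd (row_arc N v s l) = (v, s mod N)"
  by (simp add: row_arc_def hd_map)

lemma last_row_arc [simp]: "0 < l \<Longrightarrow> last (row_arc N v s l) = (v, (s + (l - 1)) mod N)"
  by (simp add: row_arc_def last_map)

lemma row_arc_append: "row_arc N v s (k + l) = row_arc N v s k @ row_arc N v (s + k) l"
  by (rule nth_equalityI) (auto simp: row_arc_def nth_append)

lemma otis_cycle_adj_Pair: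
  "otis_cycle_adj N (u, v) (u', v') \<longleftrightarrow>
     u = u' \<and> (v' = Suc v mod N \<or> v = Suc v' mod N) \<or> u = v' \<and> v = u' \<and> u \<noteq> v"
  by (simp add: otis_cycle_adj_def)

lemma otis_cycle_adj_sym: "otis_cycle_adj N p q \<Longrightarrow> otis_cycle_adj N q p"
  by (auto simp: otis_cycle_adj_def)

lemma successively_row_arc [simp]: "successively (otis_cycle_adj N) (row_arc N v s l)"
  by (auto simp: successively_conv_nth row_arc_def otis_cycle_adj_def mod_Suc_eq)

lemma successively_rev_row_arc [simp]: "successively (otis_cycle_adj N) (rev (row_arc N v s l))"
  unfolding successively_rev
  by (rule successively_mono[OF successively_row_arc]) (rule otis_cycle_adj_sym)

lemma set_row_arc:
  assumes "0 < N"
  shows "set (row_arc N v s N) = {v} \<times> {..<N}"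
proof -
  have "x \<in> (\<lambda>i. (s + i) mod N) ` {..<N}" if "x < N" for x
  proof
    \<comment> \<open>This is \<open>x - s\<close> modulo \<open>N\<close>, written so that no
      subtraction truncates.\<close>
    let ?i = "(x + (N - s mod N)) mod N"
    have "(s + ?i) mod N = (s mod N + (x + (N - s mod N))) mod N"
      by (simp add: mod_simps)
    also have "s mod N + (x + (N - s mod N)) = x + N"
      using mod_less_divisor[OF assms, of s] by linarith
    also have "(x + N) mod N = x" using that by simp
    finally show "x = (s + ?i) mod N" by simp
    show "?i \<in> {..<N}" using assms by simp
  qed
  then show ?thesis
    using assms by (auto simp: row_arc_def image_iff atLeast0LessThan)
qed

lemma set_row_arc_split:
  assumes "k + l = N" "0 < N" "t = s + k"
  shows "set (row_arc N v s k) \<union> set (row_arc N v t l) = {v} \<times> {..<N}"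
  using row_arc_append[of N v s k l] set_row_arc[OF assms(2), of v s] assms by auto

text \<open>The end points are adjacent, so this is a cycle; it is cut open at the edge that is
  removed next.\<close>

definition rows_path :: "nat \<Rightarrow> nat \<Rightarrow> (nat \<times> nat) list \<Rightarrow> bool" where
  "rows_path N m p \<longleftrightarrow> successively (otis_cycle_adj N) p \<and> p \<noteq> [] \<and>
     set p = {..<m} \<times> {..<N} \<and> length p = m * N \<and>
     hd p = (m - 1, (m + 2) mod N) \<and> last p = (m - 1, (m + 1) mod N)"

section \<open>Initial cycles and the absorption of three rows\<close>

lemma rows_path_1:
  assumes "9 \<le> N"
  shows "rows_path N 1 (row_arc N 0 3 N)"
  \<comment> \<open>Row 0 is a cycle by itself, cut between columns 2 and 3.\<close>
  using assms by (auto simp: rows_path_def set_row_arc mod_Suc)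

text \<open>The initial cycles for 6 and 8 rows were found by computer search.\<close>

lemma rows_path_6:
  assumes "9 \<le> N"
  shows "\<exists>p. rows_path N 6 p"
proof -
  \<comment> \<open>Every joint between arcs is a transposition edge. Rows 0, 1, 2 are traversed
    whole; rows 3, 4, 5 are each split into two arcs.\<close>
  define p where "p = row_arc N 5 8 (N - 5) @ row_arc N 2 5 N @ rev (row_arc N 4 1 2) @ row_arc N 1 4 N @
    row_arc N 3 1 4 @ row_arc N 4 3 (N - 2) @ row_arc N 0 4 N @ rev (row_arc N 3 5 (N - 4)) @ row_arc N 5 3 5"
  have s: "set (row_arc N v t N) = {v} \<times> {..<N}" for v t using assms by (simp add: set_row_arc)
  have "set (row_arc N 3 1 4) \<union> set (row_arc N 3 5 (N - 4)) = {3} \<times> {..<N}"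
    "set (row_arc N 4 1 2) \<union> set (row_arc N 4 3 (N - 2)) = {4} \<times> {..<N}"
    "set (row_arc N 5 3 5) \<union> set (row_arc N 5 8 (N - 5)) = {5} \<times> {..<N}"
    using assms by (intro set_row_arc_split; simp)+
  moreover have "set p = set (row_arc N 0 4 N) \<union> set (row_arc N 1 4 N) \<union> set (row_arc N 2 5 N) \<union>
      (set (row_arc N 3 1 4) \<union> set (row_arc N 3 5 (N - 4))) \<union>
      (set (row_arc N 4 1 2) \<union> set (row_arc N 4 3 (N - 2))) \<union>
      (set (row_arc N 5 3 5) \<union> set (row_arc N 5 8 (N - 5)))"
    unfolding p_def set_append set_rev by blast
  ultimately have "set p = {0, 1, 2, 3, 4, 5} \<times> {..<N}" by (auto simp only: s)
  moreover have "{0, 1, 2, 3, 4, 5} = {..<6::nat}" by auto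
  moreover have "successively (otis_cycle_adj N) p"
    using assms
    by (simp add: p_def successively_append_iff hd_append last_append hd_rev last_rev
        otis_cycle_adj_Pair mod_Suc del: successively_rev)
  moreover have "length p = 6 * N" using assms by (simp add: p_def)
  ultimately have "rows_path N 6 p"
    using assms by (simp add: rows_path_def) (simp add: p_def)
  then show ?thesis ..
qed

lemma rows_path_8:
  assumes "11 \<le> N"
  shows "\<exists>p. rows_path N 8 p"
proof -
  \<comment> \<open>Again all joints are transposition edges. Rows 0 to 4 are whole, row 5 consists
    of two arcs, rows 6 and 7 of three.\<close>
  define p where "p = row_arc N 7 10 (N - 9) @ row_arc N 0 7 N @ rev (row_arc N 6 5 (N - 4)) @
    rev (row_arc N 5 3 4) @ rev (row_arc N 3 6 N) @ row_arc N 6 3 2 @ rev (row_arc N 4 7 N) @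
    rev (row_arc N 7 1 4) @ row_arc N 1 7 N @ row_arc N 6 1 2 @ row_arc N 2 6 N @
    rev (row_arc N 5 7 (N - 4)) @ row_arc N 7 5 5"
  have s: "set (row_arc N v t N) = {v} \<times> {..<N}" for v t using assms by (simp add: set_row_arc)
  have "set (row_arc N 5 3 4) \<union> set (row_arc N 5 7 (N - 4)) = {5} \<times> {..<N}"
    "set (row_arc N 6 1 4) \<union> set (row_arc N 6 5 (N - 4)) = {6} \<times> {..<N}"
    "set (row_arc N 7 1 9) \<union> set (row_arc N 7 10 (N - 9)) = {7} \<times> {..<N}"
    using assms by (intro set_row_arc_split; simp)+
  \<comment> \<open>In the rows with three arcs, the first two in column order combine into one,
    which leaves a split into two.\<close>
  moreover have "set (row_arc N 6 1 4) = set (row_arc N 6 1 2) \<union> set (row_arc N 6 3 2)"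
    "set (row_arc N 7 1 9) = set (row_arc N 7 1 4) \<union> set (row_arc N 7 5 5)"
    using row_arc_append[of N 6 1 2 2] row_arc_append[of N 7 1 4 5] by (simp_all add: numeral_eq_Suc)
  moreover have "set p = set (row_arc N 0 7 N) \<union> set (row_arc N 1 7 N) \<union> set (row_arc N 2 6 N) \<union>
      set (row_arc N 3 6 N) \<union> set (row_arc N 4 7 N) \<union>
      (set (row_arc N 5 3 4) \<union> set (row_arc N 5 7 (N - 4))) \<union>
      (set (row_arc N 6 1 2) \<union> set (row_arc N 6 3 2) \<union> set (row_arc N 6 5 (N - 4))) \<union>
      (set (row_arc N 7 1 4) \<union> set (row_arc N 7 5 5) \<union> set (row_arc N 7 10 (N - 9)))"
    unfolding p_def set_append set_rev by blast
  ultimately have "set p = {0, 1, 2, 3, 4, 5, 6, 7} \<times> {..<N}" by (auto simp only: s)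
  moreover have "{0, 1, 2, 3, 4, 5, 6, 7} = {..<8::nat}" by auto
  moreover have "successively (otis_cycle_adj N) p"
    using assms
    by (simp add: p_def successively_append_iff hd_append last_append hd_rev last_rev
        otis_cycle_adj_Pair mod_Suc del: successively_rev)
  moreover have "length p = 8 * N" using assms by (simp add: p_def)
  ultimately have "rows_path N 8 p"
    using assms by (simp add: rows_path_def) (simp add: p_def)
  then show ?thesis ..
qed

lemma rows_path_add_3:
  assumes "9 \<le> N" "0 < m" "m + 3 \<le> N" "rows_path N m p"
  shows "\<exists>q. rows_path N (m + 3) q"
proof -
  \<comment> \<open>The four joints are the inserted transposition edges. Row \<open>m + 2\<close>
    is also cut between columns \<open>m + 4\<close> and \<open>m + 5\<close>, where the next three
    rows attach.\<close>
  define q where "q = row_arc N (m + 2) (m + 5) (N - 5) @ p @ rev (row_arc N (m + 1) m N) @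
    rev (row_arc N m (m + 2) N) @ row_arc N (m + 2) m 5"
  note p = assms(4)[unfolded rows_path_def]
  have s: "set (row_arc N v t N) = {v} \<times> {..<N}" for v t using assms by (simp add: set_row_arc)
  have "set (row_arc N (m + 2) m 5) \<union> set (row_arc N (m + 2) (m + 5) (N - 5)) = {m + 2} \<times> {..<N}"
    using assms by (intro set_row_arc_split) simp_all
  moreover have "set q = set p \<union> set (row_arc N m (m + 2) N) \<union> set (row_arc N (m + 1) m N) \<union>
      (set (row_arc N (m + 2) m 5) \<union> set (row_arc N (m + 2) (m + 5) (N - 5)))"
    unfolding q_def set_append set_rev by blast
  ultimately have "set q = ({..<m} \<union> {m, m + 1, m + 2}) \<times> {..<N}"
    using p by (auto simp only: s)
  moreover have "{..<m} \<union> {m, m + 1, m + 2} = {..<m + 3}" by auto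
  moreover have "length q = (m + 3) * N"
    using p assms by (simp add: q_def algebra_simps)
  moreover have "successively (otis_cycle_adj N) q \<and> hd q = (m + 2, (m + 5) mod N) \<and>
      last q = (m + 2, (m + 4) mod N)"
  proof -
    \<comment> \<open>Each of these three arc ends overshoots its column by exactly
      \<open>N\<close>.\<close>
    have wrap: "y mod N = x" if "y = x + N" "x < N" for x y using that by simp
    have "(m + 5 + (N - 5 - 1)) mod N = m - 1" "(m + (N - 1)) mod N = m - 1"
      "(m + 2 + (N - 1)) mod N = m + 1"
      by (rule wrap; use assms in simp)+
    moreover have "m - 1 \<noteq> m + 1" "m - 1 \<noteq> m + 2" "m + 2 \<noteq> m - 1" by simp_all
    moreover have "(m + 2) mod N = m + 2" "(m + 1) mod N = m + 1" "m mod N = m"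
      using assms by simp_all
    ultimately show ?thesis
      using p assms
      by (simp add: q_def successively_append_iff hd_append last_append hd_rev last_rev
          otis_cycle_adj_Pair del: successively_rev)
  qed
  ultimately have "rows_path N (m + 3) q"
    using assms by (simp add: rows_path_def ac_simps flip: length_greater_0_conv)
  then show ?thesis ..
qed

theorem otis_cycle_hamiltonian:
  assumes "9 \<le> N"
  shows "\<exists>p. closed_successively (otis_cycle_adj N) p \<and> set p = {..<N} \<times> {..<N} \<and>
    length p = N * N"
proof -
  have step: "\<exists>p. rows_path N (m + 3 * k) p"
    if "0 < m" "\<exists>p. rows_path N m p" "m + 3 * k \<le> N" for m k
    using that(3)
  proof (induction k)
    case (Suc k)
    then obtain p where "rows_path N (m + 3 * k) p" by auto
    then have "\<exists>q. rows_path N (m + 3 * k + 3) q"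
      using rows_path_add_3[OF assms] Suc.prems that(1) by simp
    moreover have "m + 3 * Suc k = m + 3 * k + 3" by simp
    ultimately show ?case by metis
  qed (use that in simp)
  have "\<exists>p. rows_path N N p"
  proof -
    consider "N mod 3 = 0" | "N mod 3 = 1" | "N mod 3 = 2" by linarith
    then show ?thesis
    proof cases
      case 1
      then have "N = 6 + 3 * (N div 3 - 2)" using assms by presburger
      then show ?thesis using step[of 6 "N div 3 - 2"] rows_path_6[OF assms] by simp
    next
      case 2
      then have "N = 1 + 3 * (N div 3)" by presburger
      then show ?thesis using step[of 1 "N div 3"] rows_path_1[OF assms] by auto
    next
      case 3
      \<comment> \<open>The 8-row cycle needs \<open>11 \<le> N\<close>, which the residue 2 and
        \<open>9 \<le> N\<close> enforce.\<close>
      then have "N = 8 + 3 * (N div 3 - 2)" "11 \<le> N" using assms by presburger+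
      then show ?thesis using step[of 8 "N div 3 - 2"] rows_path_8 by simp
    qed
  qed
  then obtain p where p: "rows_path N N p" ..
  \<comment> \<open>For \<open>m = N\<close> the end points wrap to columns 2 and 1 of row
    \<open>N - 1\<close>.\<close>
  then have "otis_cycle_adj N (last p) (hd p)"
    using assms by (simp add: rows_path_def otis_cycle_adj_Pair mod_Suc)
  with p show ?thesis
    by (auto simp: rows_path_def closed_successively_def)
qed

section \<open>Transfer from the cycle to graphs containing it as a spanning cycle\<close>

lemma hamiltonian_OTIS:
  assumes sym: "\<And>u v. (u, v) \<in> parcs G \<Longrightarrow> (v, u) \<in> parcs G"
    and closed: "closed_successively (\<lambda>u v. (u, v) \<in> parcs G) vs"
    and "distinct vs" "set vs = pverts G" "9 \<le> length vs"
  shows "hamiltonian (OTIS G)"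
proof -
  define N where "N = length vs"
  \<comment> \<open>\<open>f\<close> replaces positions by the vertices of \<open>vs\<close>. It
    maps row edges to edges along the cycle \<open>vs\<close>, and transposition edges to
    transposition edges.\<close>
  define f where "f = map_prod ((!) vs) ((!) vs)"
  obtain p where p: "closed_successively (otis_cycle_adj N) p"
    "set p = {..<N} \<times> {..<N}" "length p = N * N"
    using otis_cycle_hamiltonian assms(5) unfolding N_def by blast
  have ring: "(vs ! i, vs ! (Suc i mod N)) \<in> parcs G" if "i < N" for i
  proof (cases "Suc i = N")
    case True
    then have i: "i = length vs - 1" by (simp add: N_def)
    have "vs \<noteq> []" using closed by (simp add: closed_successively_def)
    then have "vs ! i = last vs" "vs ! 0 = hd vs"
      by (simp_all add: last_conv_nth hd_conv_nth i)
    moreover have "Suc i mod N = 0" using True by simp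
    ultimately show ?thesis using closed by (simp add: closed_successively_def)
  next
    case False
    then show ?thesis
      using closed that by (auto simp: N_def closed_successively_def successively_conv_nth)
  qed
  have adj: "(f a, f b) \<in> parcs (OTIS G)"
    if "otis_cycle_adj N a b" "a \<in> set p" "b \<in> set p" for a b
  proof -
    obtain i j k l where ab: "a = (i, j)" "b = (k, l)" by fastforce
    have lt: "i < N" "j < N" "k < N" "l < N" using that p(2) by (auto simp: ab)
    then have V: "vs ! i \<in> pverts G" "vs ! j \<in> pverts G"
      using assms(4) nth_mem unfolding N_def by blast+
    from that(1) consider "i = k" "l = Suc j mod N \<or> j = Suc l mod N" | "i = l" "j = k" "i \<noteq> j"
      by (auto simp: otis_cycle_adj_Pair ab)
    then show ?thesis
    proof cases
      case 1
      then have "(vs ! j, vs ! l) \<in> parcs G" using ring lt sym by metis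
      with 1 V show ?thesis by (simp add: OTIS_def f_def ab)
    next
      case 2
      \<comment> \<open>Distinctness of \<open>vs\<close> keeps the transposition edge from
        collapsing to a loop.\<close>
      then have "vs ! i \<noteq> vs ! j"
        using lt \<open>distinct vs\<close> by (simp add: N_def nth_eq_iff_index_eq)
      with 2 V show ?thesis by (simp add: OTIS_def f_def ab)
    qed
  qed
  have bij: "(!) vs ` {..<N} = pverts G"
    by (auto simp: N_def set_conv_nth simp flip: assms(4))
  show ?thesis
  proof (rule hamiltonianI)
    have "successively (otis_cycle_adj N) p" "p \<noteq> []" "otis_cycle_adj N (last p) (hd p)"
      using p(1) by (simp_all add: closed_successively_def)
    then show "closed_successively (\<lambda>u v. (u, v) \<in> parcs (OTIS G)) (map f p)"
      by (simp add: closed_successively_def successively_conv_nth hd_map last_map adj)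
    show "set (map f p) = pverts (OTIS G)"
      using p(2) bij by (simp add: f_def OTIS_def map_prod_surj_on)
    moreover have "card (pverts G) = N"
      using distinct_card[OF assms(3)] assms(4) by (simp add: N_def)
    \<comment> \<open>The list has as many entries as OTIS(G) has vertices and covers them all, so
      none repeats.\<close>
    ultimately have "card (set (map f p)) = length (map f p)"
      by (simp add: p(3) OTIS_def card_cartesian_product)
    then show "distinct (map f p)" by (rule card_distinct)
    have "9 * 9 \<le> N * N" using assms(5) by (intro mult_le_mono) (simp_all add: N_def)
    then show "3 \<le> length (map f p)" using p(3) by simp
  qed
qed

theorem mainTheorem6:
  fixes n :: nat
  assumes "n \<ge> 3"
  shows "hamiltonian (OTIS (BF n))"
proof (rule hamiltonian_OTIS)
  define z where "z = replicate n False"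
  show "(v, u) \<in> parcs (BF n)" if "(u, v) \<in> parcs (BF n)" for u v
    using that by (auto simp: BF_def)
  show "closed_successively (bf_adj n) (bf_cycle n n z)"
    using closed_bf_cycle[of n n z] assms by (simp add: z_def)
  show set: "set (bf_cycle n n z) = pverts (BF n)"
    using set_bf_cycle[of n n z] by (simp add: z_def BF_def bf_vertices_def)
  have "length (bf_cycle n n z) = n * 2 ^ n" by (simp add: length_bf_cycle)
  \<comment> \<open>Distinctness again follows by counting: the list covers all
    \<open>n * 2 ^ n\<close> vertices with that many entries.\<close>
  then show "distinct (bf_cycle n n z)"
    using set by (intro card_distinct) (simp add: card_BF)
  have "3 * 2 ^ 3 \<le> n * 2 ^ n"
    using assms by (intro mult_le_mono power_increasing) simp_all
  then show "9 \<le> length (bf_cycle n n z)"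
    by (simp add: length_bf_cycle)
qed

end
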